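(* Let $T$ be a tree on $n\geq 16$ vertices with diameter $d\geq 8$. Then $\xi_1(T)>\xi_1(T_{n,3}^{0,n-4})$.
   Context: For a connected graph $G$, the eccentricity matrix $\mathcal{E}(G)$ is the matrix indexed by $V(G)$ with $(u,v)$-entry $d_G(u,v)$ if $d_G(u,v)=\min\{e_G(u),e_G(v)\}$ and $0$ otherwise, where $d_G$ is the distance and $e_G(u)=\max_v d_G(u,v)$ the eccentricity. $\xi_1(G)$ denotes the largest eigenvalue of $\mathcal{E}(G)$. $T_{n,3}^{0,n-4}$ is the tree obtained from the path $v_0v_1v_2v_3$ by attaching $n-4$ pendant vertices to $v_2$. *)

theory Defs
  imports
    "Graph_Theory.Pair_Digraph"
    "Graph_Theory.Digraph_Component"
    "Jordan_Normal_Form.Spectral_Radius"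
begin

text \<open>
  A finite simple undirected graph is a \<^emph>\<open>pair_graph\<close>: finitely many vertices, and a symmetric
  loop-free set of arcs in which each undirected edge occurs in both directions.
\<close>

text \<open>
  The library predicate \<^emph>\<open>tree\<close> is meant for directed graphs: it treats an edge traversed back and
  forth as a cycle, so no symmetric digraph with an edge satisfies it. In a simple undirected graph
  the cycles are exactly those cycles of the symmetric digraph that have length at least 3.
\<close>

definition undirected_tree :: "'a pair_pre_digraph \<Rightarrow> bool" where
  "undirected_tree G \<longleftrightarrow>
     pair_graph G \<and> Digraph_Component.connected (with_proj G) \<and>
     \<not> (\<exists>p. pre_digraph.cycle (with_proj G) p \<and> 3 \<le> length p)"

definition gdist :: "'a pair_pre_digraph \<Rightarrow> 'a \<Rightarrow> 'a \<Rightarrow> nat" where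
  "gdist G u v = (LEAST k. \<exists>p. pre_digraph.awalk (with_proj G) u p v \<and> length p = k)"

definition eccentricity :: "'a pair_pre_digraph \<Rightarrow> 'a \<Rightarrow> nat" where
  "eccentricity G u = Max (gdist G u ` pverts G)"

definition graph_diameter :: "'a pair_pre_digraph \<Rightarrow> nat" where
  "graph_diameter G = Max (eccentricity G ` pverts G)"

definition ecc_entry :: "'a pair_pre_digraph \<Rightarrow> 'a \<Rightarrow> 'a \<Rightarrow> real" where
  "ecc_entry G u v =
     (if gdist G u v = min (eccentricity G u) (eccentricity G v) then real (gdist G u v) else 0)"

text \<open>
  Library matrices are indexed by initial segments of the naturals, so the matrix indexed by the
  vertices is written down with respect to a listing of the vertices. By \<^emph>\<open>spectrum_ecc_matrix\<close>
  below the spectrum does not depend on the listing.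
\<close>

definition ecc_matrix :: "'a pair_pre_digraph \<Rightarrow> 'a list \<Rightarrow> real mat" where
  "ecc_matrix G vs =
     mat (length vs) (length vs) (\<lambda>(i, j). ecc_entry G (vs ! i) (vs ! j))"

definition vertex_listing :: "'a pair_pre_digraph \<Rightarrow> 'a list" where
  "vertex_listing G = (SOME vs. distinct vs \<and> set vs = pverts G)"

definition ecc_xi1 :: "'a pair_pre_digraph \<Rightarrow> real" where
  "ecc_xi1 G = Max (spectrum (ecc_matrix G (vertex_listing G)))"

text \<open>
  Vertices 0, 1, 2, 3 form the path and 4, ..., n - 1 are the n - 4 pendant vertices attached to 2
  (intended for n at least 4).
\<close>

definition broom_tree :: "nat \<Rightarrow> nat pair_pre_digraph" where
  "broom_tree n =
     (let E = {(0, 1), (1, 2), (2, 3)} \<union> {2} \<times> {4..<n}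
      in \<lparr> pverts = {0..<n}, parcs = E \<union> E\<inverse> \<rparr>)"

lemma spectrum_ecc_matrix:
  assumes vs: "distinct vs" "set vs = pverts G"
  shows "spectrum (ecc_matrix G vs) =
    {k. \<exists>x. (\<exists>u\<in>pverts G. x u \<noteq> 0) \<and>
        (\<forall>u\<in>pverts G. (\<Sum>v\<in>pverts G. ecc_entry G u v * x v) = k * x u)}"
    (is "_ = ?R")
proof -
  let ?n = "length vs"
  let ?M = "ecc_matrix G vs"
  have M: "?M \<in> carrier_mat ?n ?n" by (simp add: ecc_matrix_def)
  have reindex: "(\<Sum>v\<in>pverts G. f v) = (\<Sum>j<?n. f (vs ! j))" for f :: "'a \<Rightarrow> real"
    using sum.reindex_bij_betw[OF bij_betw_nth[OF vs(1) refl refl], of f] vs(2) by simp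
  have mult: "(?M *\<^sub>v w) $ i = (\<Sum>j<?n. ecc_entry G (vs ! i) (vs ! j) * w $ j)"
    if "i < ?n" "w \<in> carrier_vec ?n" for i w
    using that by (auto simp: ecc_matrix_def scalar_prod_def atLeast0LessThan intro!: sum.cong)
  have in_set: "(\<forall>u\<in>pverts G. P u) \<longleftrightarrow> (\<forall>i<?n. P (vs ! i))" for P
    using vs(2) by (metis in_set_conv_nth)
  have "eigenvalue ?M k \<longleftrightarrow> k \<in> ?R" for k
  proof
    assume "eigenvalue ?M k"
    then obtain w where w: "w \<in> carrier_vec ?n" "w \<noteq> 0\<^sub>v ?n" "?M *\<^sub>v w = k \<cdot>\<^sub>v w"
      using M unfolding eigenvalue_def eigenvector_def by auto
    obtain x where x: "x (vs ! i) = w $ i" if "i < ?n" for i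
    proof (rule that)
      fix i assume "i < ?n"
      then show "(\<lambda>u. w $ the_inv_into {..<?n} ((!) vs) u) (vs ! i) = w $ i"
        using vs(1) by (simp add: the_inv_into_f_f inj_on_nth)
    qed
    have "\<not> (\<forall>u\<in>pverts G. x u = 0)"
    proof
      assume "\<forall>u\<in>pverts G. x u = 0"
      then have "\<forall>i<?n. w $ i = 0" unfolding in_set using x by simp
      then have "w = 0\<^sub>v ?n" using w(1) by auto
      with w(2) show False by simp
    qed
    moreover have "\<forall>u\<in>pverts G. (\<Sum>v\<in>pverts G. ecc_entry G u v * x v) = k * x u"
      unfolding in_set reindex
    proof (intro allI impI)
      fix i assume i: "i < ?n"
      have "(\<Sum>j<?n. ecc_entry G (vs ! i) (vs ! j) * x (vs ! j)) = (?M *\<^sub>v w) $ i"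
        using mult[OF i w(1)] x by simp
      also have "\<dots> = k * x (vs ! i)" using w i x by simp
      finally show "(\<Sum>j<?n. ecc_entry G (vs ! i) (vs ! j) * x (vs ! j)) = k * x (vs ! i)" .
    qed
    ultimately show "k \<in> ?R" by blast
  next
    assume "k \<in> ?R"
    then obtain x where nz: "\<exists>u\<in>pverts G. x u \<noteq> 0"
      and eq: "\<forall>u\<in>pverts G. (\<Sum>v\<in>pverts G. ecc_entry G u v * x v) = k * x u" by blast
    define w where "w = vec ?n (\<lambda>i. x (vs ! i))"
    have w: "w \<in> carrier_vec ?n" by (simp add: w_def)
    have "w \<noteq> 0\<^sub>v ?n"
    proof
      assume 0: "w = 0\<^sub>v ?n"
      have "x (vs ! i) = 0" if "i < ?n" for i
        using arg_cong[OF 0, of "\<lambda>v. v $ i"] that by (simp add: w_def)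
      then have "\<forall>u\<in>pverts G. x u = 0" unfolding in_set by blast
      with nz show False by blast
    qed
    moreover have "?M *\<^sub>v w = k \<cdot>\<^sub>v w"
    proof (rule eq_vecI)
      fix i assume "i < dim_vec (k \<cdot>\<^sub>v w)"
      then have i: "i < ?n" using w by simp
      have "(?M *\<^sub>v w) $ i = (\<Sum>j<?n. ecc_entry G (vs ! i) (vs ! j) * x (vs ! j))"
        using mult[OF i w] by (simp add: w_def)
      also have "\<dots> = k * x (vs ! i)" using eq i unfolding in_set reindex by blast
      finally show "(?M *\<^sub>v w) $ i = (k \<cdot>\<^sub>v w) $ i" using i by (simp add: w_def)
    qed (use M w in auto)
    ultimately show "eigenvalue ?M k"
      using w M unfolding eigenvalue_def eigenvector_def by auto
  qed
  then show ?thesis unfolding spectrum_def by blast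
qed

end

theory Submission
  imports Defs "HOL-Analysis.Function_Topology"
begin

text \<open>
  For the broom, the eigenvalue equations give \<open>(t - 4) (t - 4 m) = 9 m t\<close> for
  \<open>t = \<xi>\<^sub>1\<^sup>2\<close> and \<open>m = n - 3\<close> (unless \<open>t = 0\<close>), whence \<open>t \<le> 13 m + 4\<close>.

  For the tree, fix a diametral pair \<open>a\<close>, \<open>b\<close>. Every vertex \<open>v\<close> has one of them as a farthest vertex, so
  the entries at \<open>(v, a)\<close> and \<open>(v, b)\<close> have a large sum \<open>w v\<close>. A trial vector equal to \<open>w\<close> off
  \<open>{a, b}\<close> and to a suitable constant on \<open>{a, b}\<close> bounds \<open>\<xi>\<^sub>1\<^sup>2\<close> from below by \<open>\<Sum>v. (w v)\<^sup>2 / 2\<close>.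
  For diameter at least 8, parity of distance sums in a tree gives \<open>w v \<ge> 6\<close> except at \<open>a\<close>, \<open>b\<close> and the at most
  two vertices of the diametral path at distance 5 from one end, so the bound is
  \<open>18 (n - 4) > 13 n - 35\<close>.
\<close>

section \<open>Distances in trees\<close>

context pair_pre_digraph begin

lemma pawalk_iff: "awalk u p v \<longleftrightarrow> u \<in> pverts G \<and> set p \<subseteq> parcs G \<and> pcas u p v"
  by (simp add: awalk_def)

lemma gdist_le_length: "awalk u p v \<Longrightarrow> gdist G u v \<le> length p"
  unfolding gdist_def by (rule Least_le) auto

lemma gdist_awalk:
  assumes "awalk u p v"
  obtains q where "awalk u q v" "length q = gdist G u v"
proof -
  have "\<exists>q. awalk u q v \<and> length q = gdist G u v"
    unfolding gdist_def by (rule LeastI_ex) (use assms in auto)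
  with that show thesis by blast
qed

text \<open>A potential \<open>f\<close> certifies distances: growing by at most one per arc, it
  bounds every walk length from below, and descending along predecessors to \<open>u\<close> builds
  a walk of length \<open>f v\<close>. Distances in the broom are read off this way.\<close>

lemma gdist_eqI:
  assumes u: "u \<in> pverts G" "f u = 0"
    and lip: "\<And>x y. (x, y) \<in> parcs G \<Longrightarrow> f y \<le> Suc (f x)"
    and pred: "\<And>v. v \<in> pverts G \<Longrightarrow> v \<noteq> u \<Longrightarrow> \<exists>x\<in>pverts G. (x, v) \<in> parcs G \<and> f v = Suc (f x)"
    and v: "v \<in> pverts G"
  shows "gdist G u v = f v"
proof -
  have append: "pcas x (p @ q) z" if "pcas x p y" "pcas y q z" for x p y q z
    using that by (induction p arbitrary: x) auto
  have ex: "\<exists>p. awalk u p v \<and> length p = f v" if "v \<in> pverts G" for v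
    using that
  proof (induction "f v" arbitrary: v rule: less_induct)
    case less
    show ?case
    proof (cases "v = u")
      case True
      with u have "awalk u [] v \<and> length [] = f v" by (simp add: pawalk_iff)
      then show ?thesis by blast
    next
      case False
      with pred less.prems obtain x
        where x: "x \<in> pverts G" "(x, v) \<in> parcs G" "f v = Suc (f x)" by blast
      with less.hyps[of x] obtain p where "awalk u p x" "length p = f x" by auto
      with x have "awalk u (p @ [(x, v)]) v \<and> length (p @ [(x, v)]) = f v"
        using append[of u p x "[(x, v)]" v] by (simp add: pawalk_iff)
      then show ?thesis by blast
    qed
  qed
  have ge: "f z \<le> f y + length p" if "set p \<subseteq> parcs G" "pcas y p z" for y p z
    using that
  proof (induction p arbitrary: y)
    case (Cons e p)
    then show ?case using lip[of y "snd e"] by (cases e) fastforce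
  qed simp
  from ex[OF v] obtain p where p: "awalk u p v" "length p = f v" by blast
  obtain q where "awalk u q v" "length q = gdist G u v" using gdist_awalk[OF p(1)] .
  with ge[of q u v] u gdist_le_length[OF p(1)] p(2) show ?thesis by (simp add: pawalk_iff)
qed

end

section \<open>The metric of an undirected tree\<close>

locale undirected_tree_graph = pair_graph G for G :: "'a pair_pre_digraph" +
  assumes conn: "Digraph_Component.connected (with_proj G)"
    and acyclic: "\<not> (\<exists>p. cycle p \<and> 3 \<le> length p)"
begin

abbreviation d :: "'a \<Rightarrow> 'a \<Rightarrow> nat" where "d \<equiv> gdist G"
abbreviation V :: "'a set" where "V \<equiv> pverts G"

lemma arc_sym: "(x, y) \<in> parcs G \<Longrightarrow> (y, x) \<in> parcs G"
  using pair_sym_arcs by (auto simp: symmetric_def sym_def)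

lemma awalk_rev: "awalk u p v \<Longrightarrow> awalk v (rev (map prod.swap p)) u"
proof (induction p arbitrary: u)
  case Nil
  then show ?case by (auto simp: awalk_Nil_iff)
next
  case (Cons e p)
  obtain x y where e: "e = (x, y)" by force
  have *: "(x, y) \<in> parcs G" "u = x" "awalk y p v" using Cons.prems by (auto simp: e awalk_Cons_iff)
  then have "(y, x) \<in> parcs G" using arc_sym by blast
  then have "awalk y [(y, x)] x" using in_arcsD2[OF *(1)] by (simp add: pawalk_iff)
  with Cons.IH[OF *(3)] show ?case
    unfolding e using *(2) by (auto intro: awalk_appendI)
qed

lemma geodesic:
  assumes "u \<in> V" "v \<in> V"
  obtains p where "awalk u p v" "length p = d u v"
proof -
  \<comment> \<open>Connectedness refers to the symmetric closure, which here adds no arcs, so it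
    yields walks in \<open>G\<close> itself.\<close>
  have "mk_symmetric (with_proj G) = G"
    by (rule pair_pre_digraph.equality)
      (auto simp: parcs_mk_symmetric intro: arc_sym)
  then have "u \<rightarrow>\<^sup>*\<^bsub>with_proj G\<^esub> v" using conn assms unfolding Digraph_Component.connected_def
    by (auto simp: strongly_connected_def)
  then obtain p where "awalk u p v" unfolding reachable_awalk by blast
  then show thesis by (rule gdist_awalk) (rule that)
qed

lemma d_refl: "u \<in> V \<Longrightarrow> d u u = 0"
  using gdist_le_length[of u "[]" u] by (simp add: awalk_Nil_iff)

lemma d_eq_0:
  assumes "u \<in> V" "v \<in> V"
  shows "d u v = 0 \<longleftrightarrow> u = v"
proof
  assume 0: "d u v = 0"
  obtain p where "awalk u p v" "length p = d u v" using geodesic assms by blast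
  with 0 show "u = v" by (simp add: awalk_Nil_iff)
qed (use assms d_refl in simp)

lemma d_le:
  assumes "u \<in> V" "v \<in> V"
  shows "d u v \<le> d v u"
proof -
  obtain p where "awalk v p u" "length p = d v u" using geodesic assms by blast
  then show ?thesis using gdist_le_length[OF awalk_rev, of v p u] by simp
qed

lemma d_sym: "u \<in> V \<Longrightarrow> v \<in> V \<Longrightarrow> d u v = d v u"
  using d_le by (simp add: le_antisym)

lemma d_triangle:
  assumes "u \<in> V" "v \<in> V" "w \<in> V"
  shows "d u w \<le> d u v + d v w"
proof -
  obtain p where p: "awalk u p v" "length p = d u v" using geodesic assms by blast
  obtain q where q: "awalk v q w" "length q = d v w" using geodesic assms by blast
  show ?thesis using gdist_le_length[OF awalk_appendI[OF p(1) q(1)]] p q by simp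
qed

lemma d_arc:
  assumes "(x, y) \<in> parcs G"
  shows "d x y = 1"
proof -
  have V: "x \<in> V" "y \<in> V" using assms wellformed' by auto
  have "d x y \<le> 1"
    using gdist_le_length[of x "[(x, y)]" y] assms V by (simp add: pawalk_iff)
  moreover have "d x y \<noteq> 0" using d_eq_0 V no_loops'[OF assms] by simp
  ultimately show ?thesis by simp
qed

text \<open>The head of the first arc of a geodesic. This is the step of the later inductions on
  distance.\<close>

lemma next_vertex:
  assumes "x \<in> V" "y \<in> V" "x \<noteq> y"
  obtains x' where "(x, x') \<in> parcs G" "x' \<in> V" "d x y = Suc (d x' y)"
proof -
  obtain p where p: "awalk x p y" "length p = d x y" using geodesic assms by blast
  then obtain e q where "p = e # q" using assms by (cases p) (auto simp: awalk_Nil_iff)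
  with p obtain x' where *: "(x, x') \<in> parcs G" "awalk x' q y" "length q = d x y - 1" "d x y \<noteq> 0"
    by (cases e) (auto simp: awalk_Cons_iff)
  have x': "x' \<in> V" using *(1) wellformed' by auto
  have "d x y \<le> Suc (d x' y)"
    using d_triangle[OF assms(1) x' assms(2)] d_arc[OF *(1)] by simp
  moreover have "d x' y \<le> d x y - 1" using gdist_le_length[OF *(2)] *(3) by simp
  ultimately show thesis using *(4) by (intro that[OF *(1) x']) simp
qed

section \<open>Metric consequences of acyclicity\<close>

text \<open>Acyclicity enters the metric arguments here, in the form that every edge is a bridge: a
  walk avoiding the arc would contain a path that closes up to a cycle.\<close>

lemma arc_bridge:
  assumes e: "(x, y) \<in> parcs G" and p: "awalk x p y"
  shows "(x, y) \<in> set p"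
proof (rule ccontr)
  assume nin: "(x, y) \<notin> set p"
  define q where "q = awalk_to_apath p"
  have q: "apath x q y" "(x, y) \<notin> set q"
    using apath_awalk_to_apath[OF p] awalk_to_apath_subset[OF p] nin by (auto simp: q_def)
  have ne: "x \<noteq> y" using no_loops'[OF e] .
  have w: "awalk x q y" using q(1) by (simp add: apath_def)
  have len: "2 \<le> length q"
  proof (rule ccontr)
    assume "\<not> 2 \<le> length q"
    then consider "q = []" | e' where "q = [e']" by (cases q; cases "tl q") auto
    then show False
    proof cases
      case 1
      then show False using w ne by (simp add: awalk_Nil_iff)
    next
      case 2
      then show False using w q(2) by (cases e') (auto simp: awalk_Cons_iff awalk_Nil_iff)
    qed
  qed
  \<comment> \<open>Closing the path by the arc \<open>(y, x)\<close> yields a cycle of length at least 3.\<close>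
  have "awalk y ((y, x) # q) y" using w arc_sym[OF e] by (simp add: awalk_Cons_iff)
  moreover have "distinct (tl (pawalk_verts y ((y, x) # q)))" using q(1) by (simp add: apath_def)
  ultimately have "cycle ((y, x) # q)" unfolding cycle_def by blast
  with acyclic len show False by fastforce
qed

lemma geodesic_split:
  assumes p: "awalk u p v" "length p = d u v" and e: "(x, y) \<in> set p"
  shows "d u v = Suc (d u x + d y v)"
proof -
  obtain p1 p2 where p12: "p = p1 @ (x, y) # p2" using split_list[OF e] by blast
  have w: "awalk u p1 x" "awalk y p2 v" and xy: "(x, y) \<in> parcs G"
    using p(1) unfolding p12 by (auto simp: awalk_Cons_iff)
  have V: "u \<in> V" "x \<in> V" "y \<in> V" "v \<in> V" using w xy wellformed' by auto
  have "d u v \<ge> Suc (d u x + d y v)"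
    using gdist_le_length[OF w(1)] gdist_le_length[OF w(2)] p(2) p12 by simp
  moreover have "d u v \<le> d u x + (d x y + d y v)"
    using d_triangle[of u x v] d_triangle[of x y v] V by linarith
  ultimately show ?thesis using d_arc[OF xy] by simp
qed

text \<open>Trees are bipartite. Geodesics from \<open>x\<close> to \<open>w\<close> and from
  \<open>w\<close> to \<open>y\<close> together must cross the bridge, and whichever of them does so
  makes one of the two distances strictly larger.\<close>

lemma d_arc_neq:
  assumes e: "(x, y) \<in> parcs G" and w: "w \<in> V"
  shows "d w x \<noteq> d w y"
proof
  assume eq: "d w x = d w y"
  have V: "x \<in> V" "y \<in> V" using e wellformed' by auto
  obtain p where p: "awalk x p w" "length p = d x w" using geodesic V w by blast
  obtain q where q: "awalk w q y" "length q = d w y" using geodesic V w by blast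
  have "(x, y) \<in> set p \<union> set q" using arc_bridge[OF e awalk_appendI[OF p(1) q(1)]] by simp
  then show False
  proof
    assume "(x, y) \<in> set p"
    from geodesic_split[OF p this] show False using d_sym[OF V(1) w] d_sym[OF V(2) w] eq by simp
  next
    assume "(x, y) \<in> set q"
    from geodesic_split[OF q this] show False using eq by simp
  qed
qed

lemma d_arc_cases:
  assumes e: "(x, y) \<in> parcs G" and w: "w \<in> V"
  shows "d w y = Suc (d w x) \<or> d w x = Suc (d w y)"
proof -
  have V: "x \<in> V" "y \<in> V" using e wellformed' by auto
  show ?thesis
    using d_arc_neq[OF e w] d_triangle[OF w V(1,2)] d_triangle[OF w V(2,1)]
      d_arc[OF e] d_arc[OF arc_sym[OF e]] by linarith
qed

text \<open>The walk from \<open>x\<close> via \<open>u\<close> and \<open>v\<close> to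
  \<open>y\<close> crosses the bridge. Its outer legs cannot: crossing there would contradict that
  \<open>u\<close> lies on the side of \<open>x\<close> and \<open>v\<close> on the side of
  \<open>y\<close>. So the geodesic from \<open>u\<close> to \<open>v\<close> does.\<close>

lemma d_across_arc:
  assumes e: "(x, y) \<in> parcs G" and V: "u \<in> V" "v \<in> V"
    and u: "d u x \<le> d u y" and v: "d v y \<le> d v x"
  shows "d u v = Suc (d u x + d y v)"
proof -
  have xy: "x \<in> V" "y \<in> V" using e wellformed' by auto
  obtain p where p: "awalk x p u" "length p = d x u" using geodesic V xy by blast
  obtain q where q: "awalk u q v" "length q = d u v" using geodesic V xy by blast
  obtain r where r: "awalk v r y" "length r = d v y" using geodesic V xy by blast
  have "(x, y) \<in> set p \<union> set q \<union> set r"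
    using arc_bridge[OF e awalk_appendI[OF p(1) awalk_appendI[OF q(1) r(1)]]] by auto
  moreover have "(x, y) \<notin> set p"
    using geodesic_split[OF p, of x y] d_sym[OF xy(1) V(1)] d_sym[OF xy(2) V(1)] u by linarith
  moreover have "(x, y) \<notin> set r"
    using geodesic_split[OF r, of x y] v by linarith
  ultimately show ?thesis using geodesic_split[OF q] by blast
qed

text \<open>Moving \<open>u\<close> one arc towards \<open>v\<close> lowers \<open>d u v\<close> by
  one and changes \<open>d w u\<close> by exactly one, so the parity is preserved.\<close>

lemma d_parity:
  assumes "u \<in> V" "v \<in> V" "w \<in> V"
  shows "even (d w u + d w v + d u v)"
  using assms
proof (induction "d u v" arbitrary: u)
  case 0
  then show ?case using d_eq_0 by force
next
  case (Suc n)
  then have "u \<noteq> v" using d_refl by force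
  then obtain u' where u': "(u, u') \<in> parcs G" "u' \<in> V" "d u v = Suc (d u' v)"
    using next_vertex Suc.prems by blast
  with Suc have "even (d w u' + d w v + d u' v)" by simp
  then show ?case using d_arc_cases[OF u'(1) \<open>w \<in> V\<close>] u'(3) by auto
qed

text \<open>Move \<open>x\<close> one arc towards \<open>y\<close>. If this also approaches both
  \<open>u\<close> and \<open>v\<close>, all three distances from \<open>x\<close> drop by one and
  induction applies. Otherwise the arc separates some \<open>w\<close> among \<open>u\<close>,
  \<open>v\<close> from \<open>y\<close>, so \<open>x\<close> lies between \<open>w\<close> and
  \<open>y\<close>, and the triangle inequality suffices.\<close>

lemma four_point:
  assumes "x \<in> V" "y \<in> V" "u \<in> V" "v \<in> V"
  shows "d x y + d u v \<le> max (d x u + d y v) (d x v + d y u)"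
  using assms
proof (induction "d x y" arbitrary: x)
  case 0
  then have "x = y" using d_eq_0 by simp
  then show ?case using d_triangle[of u x v] d_sym[of u x] d_refl 0 by simp
next
  case (Suc n)
  then have "x \<noteq> y" using d_refl by force
  then obtain x' where x': "(x, x') \<in> parcs G" "x' \<in> V" "d x y = Suc (d x' y)"
    using next_vertex Suc.prems by blast
  have sym: "d a b = d b a" if "a \<in> {x, x', y, u, v}" "b \<in> {x, x', y, u, v}" for a b
    using that d_sym Suc.prems x'(2) by blast
  have far: ?case if w: "w \<in> {u, v}" "w' \<in> {u, v}" "{w, w'} = {u, v}" "d w x' = Suc (d w x)" for w w'
  proof -
    have wV: "w \<in> V" "w' \<in> V" using w Suc.prems by auto
    have "d w y = Suc (d w x + d x' y)"
      by (rule d_across_arc[OF x'(1) wV(1) \<open>y \<in> V\<close>]) (use w x'(3) sym in auto)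
    moreover have "d w w' \<le> d w x + d x w'" using d_triangle wV \<open>x \<in> V\<close> by blast
    ultimately have "d x y + d w w' \<le> d y w + d x w'" using x'(3) w sym[of y w] by auto
    then show ?thesis using w(3) sym[of u v] by (auto simp: doubleton_eq_iff)
  qed
  show ?case
  proof (cases "d u x = Suc (d u x') \<and> d v x = Suc (d v x')")
    case True
    have "d x' y + d u v \<le> max (d x' u + d y v) (d x' v + d y u)"
      using Suc x' by auto
    then show ?thesis using True x'(3) sym[of x u] sym[of x' u] sym[of x v] sym[of x' v] by auto
  next
    case False
    then show ?thesis
      using d_arc_cases[OF x'(1), of u] d_arc_cases[OF x'(1), of v] Suc.prems
        far[of u v] far[of v u] by auto
  qed
qed

text \<open>In the four-point condition for \<open>u\<close>, \<open>v\<close>, \<open>a\<close>,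
  \<open>b\<close> both candidates on the right equal \<open>d a b\<close>, which leaves no room for
  \<open>d u v\<close>.\<close>

lemma geodesic_point_unique:
  assumes "a \<in> V" "b \<in> V" "u \<in> V" "v \<in> V"
    and "d a u = d a v" "d a u + d u b = d a b" "d b u = d b v"
  shows "u = v"
proof -
  have "d u v = 0" using four_point[OF assms(3,4,1,2)] assms(5-) d_sym[OF assms(1,3)] d_sym[OF assms(1,4)]
      d_sym[OF assms(2,3)] d_sym[OF assms(2,4)] by simp
  then show ?thesis using d_eq_0 assms by blast
qed

end

section \<open>The top eigenvalue of a symmetric matrix\<close>

text \<open>Vectors are functions on the whole type. Bounding the coordinates outside
  \<open>V\<close> as well puts the set inside a product of compact intervals, where Tychonoff's
  theorem applies.\<close>

lemma compact_unit_vectors: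
  assumes "finite V"
  shows "compact {x :: 'a \<Rightarrow> real. (\<forall>u. x u \<in> {-1..1}) \<and> (\<Sum>u\<in>V. (x u)\<^sup>2) = 1}"
proof -
  have "compactin (product_topology (\<lambda>_ :: 'a. euclidean) UNIV) (PiE UNIV (\<lambda>_. {-1..1 :: real}))"
    unfolding compactin_PiE by simp
  then have "compact (PiE UNIV (\<lambda>_ :: 'a. {-1..1 :: real}))"
    by (simp add: euclidean_product_topology)
  moreover have "closed {x :: 'a \<Rightarrow> real. (\<Sum>u\<in>V. (x u)\<^sup>2) = 1}"
    by (intro closed_Collect_eq continuous_intros continuous_on_product_coordinates)
  ultimately have "compact (PiE UNIV (\<lambda>_ :: 'a. {-1..1 :: real}) \<inter> {x. (\<Sum>u\<in>V. (x u)\<^sup>2) = 1})"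
    by (rule compact_Int_closed)
  also have "PiE UNIV (\<lambda>_ :: 'a. {-1..1 :: real}) \<inter> {x. (\<Sum>u\<in>V. (x u)\<^sup>2) = 1} =
      {x. (\<forall>u. x u \<in> {-1..1}) \<and> (\<Sum>u\<in>V. (x u)\<^sup>2) = 1}"
    by (auto simp: PiE_def Pi_def)
  finally show ?thesis .
qed

lemma linear_coeff_eq_0_if_quadratic_nonneg:
  fixes b c :: real
  assumes "\<And>t. 0 \<le> t * b + t\<^sup>2 * c"
  shows "b = 0"
proof (rule ccontr)
  assume "b \<noteq> 0"
  \<comment> \<open>At \<open>t = - b / r\<close> the polynomial is b^2 (c - r) / r^2, negative once
    \<open>r\<close> exceeds \<open>c\<close>.\<close>
  define r where "r = \<bar>c\<bar> + 1"
  have r: "r > 0" "c < r" by (auto simp: r_def)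
  have "0 \<le> (- b / r) * b + (- b / r)\<^sup>2 * c" by (rule assms)
  also have "\<dots> = b\<^sup>2 * (c - r) / r\<^sup>2" using r by (simp add: field_simps power2_eq_square)
  also have "\<dots> < 0" using r \<open>b \<noteq> 0\<close> by (intro divide_neg_pos mult_pos_neg) auto
  finally show False by simp
qed

text \<open>The quadratic form attains its maximum \<open>k\<close> on the compact unit sphere.
  Scaling turns this into the Rayleigh bound for all vectors, and optimality makes the maximiser an
  eigenvector.\<close>

lemma symmetric_top_eigenvector:
  fixes M :: "'a \<Rightarrow> 'a \<Rightarrow> real"
  assumes fin: "finite V" and ne: "V \<noteq> {}"
    and sym: "\<And>u v. u \<in> V \<Longrightarrow> v \<in> V \<Longrightarrow> M u v = M v u"
  obtains k x where "\<exists>u\<in>V. x u \<noteq> 0" "\<forall>u\<in>V. (\<Sum>v\<in>V. M u v * x v) = k * x u"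
    "\<And>y. (\<Sum>u\<in>V. \<Sum>v\<in>V. M u v * y u * y v) \<le> k * (\<Sum>u\<in>V. (y u)\<^sup>2)"
proof -
  define S where "S = {x :: 'a \<Rightarrow> real. (\<forall>u. x u \<in> {-1..1}) \<and> (\<Sum>u\<in>V. (x u)\<^sup>2) = 1}"
  define B where "B f g = (\<Sum>u\<in>V. \<Sum>v\<in>V. M u v * f u * g v)" for f g
  define N where "N f = (\<Sum>u\<in>V. (f u)\<^sup>2)" for f :: "'a \<Rightarrow> real"
  define e :: "'a \<Rightarrow> 'a \<Rightarrow> real" where "e w u = (if u = w then 1 else 0)" for w u
  have N_e: "N (e w) = 1" if "w \<in> V" for w
    using that fin unfolding N_def e_def by (simp add: if_distrib [of "\<lambda>z. z\<^sup>2"] cong: if_cong)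
  have "compact S" unfolding S_def by (rule compact_unit_vectors[OF fin])
  moreover obtain w where "w \<in> V" using ne by blast
  then have "e w \<in> S" using N_e[of w] by (simp add: S_def N_def) (simp add: e_def)
  then have "S \<noteq> {}" by blast
  moreover have "continuous_on S (\<lambda>x. B x x)"
    unfolding B_def
    by (intro continuous_intros continuous_on_subset[OF continuous_on_product_coordinates]) auto
  ultimately obtain x where x: "x \<in> S" "\<And>y. y \<in> S \<Longrightarrow> B y y \<le> B x x"
    using continuous_attains_sup[of S "\<lambda>x. B x x"] by blast
  define k where "k = B x x"
  have Nx: "N x = 1" using x(1) by (simp add: S_def N_def)
  have bound: "B y y \<le> k * N y" for y
  proof (cases "N y = 0")
    case True
    then have "\<forall>u\<in>V. y u = 0" using fin by (simp add: N_def sum_nonneg_eq_0_iff)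
    then show ?thesis using True by (simp add: B_def)
  next
    case False
    then have pos: "N y > 0" using sum_nonneg[of V "\<lambda>u. (y u)\<^sup>2"] by (simp add: N_def)
    \<comment> \<open>Setting \<open>z\<close> to zero off \<open>V\<close> keeps all its
      coordinates in the interval demanded by \<open>S\<close>.\<close>
    define z where "z u = (if u \<in> V then y u / sqrt (N y) else 0)" for u
    have "(y u)\<^sup>2 \<le> N y" if "u \<in> V" for u
      unfolding N_def using that fin by (intro member_le_sum) auto
    then have "\<bar>y u\<bar> \<le> sqrt (N y)" if "u \<in> V" for u
      using that real_le_rsqrt[of "\<bar>y u\<bar>"] by simp
    then have "\<bar>z u\<bar> \<le> 1" for u using pos by (simp add: z_def)
    then have "\<forall>u. z u \<in> {-1..1}" by (simp add: abs_le_iff minus_le_iff)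
    moreover have "N z = N y / N y"
      unfolding N_def[of z] N_def[of y] sum_divide_distrib
      using pos by (intro sum.cong refl) (simp add: z_def power_divide N_def)
    then have "N z = 1" using pos by simp
    ultimately have "z \<in> S" by (simp add: S_def N_def)
    then have "B z z \<le> k" using x(2) by (simp add: k_def)
    moreover have "B z z = B y y / N y"
      unfolding B_def sum_divide_distrib using pos by (intro sum.cong refl) (simp add: z_def)
    ultimately show ?thesis using pos by (simp add: divide_le_eq)
  qed
  have eig: "(\<Sum>v\<in>V. M w v * x v) = k * x w" if w: "w \<in> V" for w
  proof -
    let ?m = "\<Sum>v\<in>V. M w v * x v"
    have delta: "(\<Sum>v\<in>V. f v * e w v) = f w" for f
    proof -
      have "(\<Sum>v\<in>V. f v * e w v) = (\<Sum>v\<in>V. if v = w then f v else 0)"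
        by (intro sum.cong refl) (simp add: e_def)
      then show ?thesis using w fin by simp
    qed
    have Bxe: "B x (e w) = ?m"
      unfolding B_def delta by (intro sum.cong refl) (simp add: sym[OF _ w])
    have Bex: "B (e w) x = ?m"
    proof -
      have "B (e w) x = (\<Sum>u\<in>V. (\<Sum>v\<in>V. M u v * x v) * e w u)"
        unfolding B_def sum_distrib_right by (intro sum.cong refl) (simp add: mult_ac)
      then show ?thesis by (simp add: delta)
    qed
    have expB: "B (\<lambda>u. x u + t * e w u) (\<lambda>u. x u + t * e w u) = k + 2 * t * ?m + t\<^sup>2 * B (e w) (e w)" for t
    proof -
      have "B (\<lambda>u. x u + t * e w u) (\<lambda>u. x u + t * e w u) =
          B x x + t * B x (e w) + t * B (e w) x + t\<^sup>2 * B (e w) (e w)"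
        unfolding B_def sum_distrib_left sum.distrib[symmetric]
        by (intro sum.cong refl) (simp add: algebra_simps power2_eq_square)
      then show ?thesis by (simp add: Bxe Bex k_def)
    qed
    have expN: "N (\<lambda>u. x u + t * e w u) = 1 + 2 * t * x w + t\<^sup>2" for t
    proof -
      have "N (\<lambda>u. x u + t * e w u) = N x + 2 * t * (\<Sum>u\<in>V. x u * e w u) + t\<^sup>2 * N (e w)"
        unfolding N_def sum_distrib_left sum.distrib[symmetric]
        by (intro sum.cong refl) (simp add: algebra_simps power2_eq_square)
      then show ?thesis using Nx N_e[OF w] delta by simp
    qed
    \<comment> \<open>First-order optimality of \<open>x\<close> in the direction of the unit vector \<open>e w\<close>.\<close>
    have "0 \<le> t * (2 * (k * x w - ?m)) + t\<^sup>2 * (k - B (e w) (e w))" for t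
      using bound[of "\<lambda>u. x u + t * e w u"] unfolding expB expN by (simp add: algebra_simps)
    then have "2 * (k * x w - ?m) = 0" by (rule linear_coeff_eq_0_if_quadratic_nonneg)
    then show ?thesis by simp
  qed
  have "\<exists>u\<in>V. x u \<noteq> 0"
  proof (rule ccontr)
    assume "\<not> (\<exists>u\<in>V. x u \<noteq> 0)"
    then show False using Nx by (simp add: N_def)
  qed
  then show thesis using eig bound unfolding B_def N_def by (intro that[of x k]) auto
qed

section \<open>The largest eigenvalue of the eccentricity matrix\<close>

text \<open>\<open>Max\<close> is meaningful because the spectrum is finite and contains the top
  eigenvalue \<open>k\<close> of the symmetric form. The Rayleigh bound for \<open>k\<close> passes
  on to the maximum.\<close>

lemma
  assumes fin: "finite (pverts G)" and ne: "pverts G \<noteq> {}"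
    and sym: "\<And>u v. u \<in> pverts G \<Longrightarrow> v \<in> pverts G \<Longrightarrow> gdist G u v = gdist G v u"
  shows ecc_xi1_eigenvector: "\<exists>x. (\<exists>u\<in>pverts G. x u \<noteq> 0) \<and>
      (\<forall>u\<in>pverts G. (\<Sum>v\<in>pverts G. ecc_entry G u v * x v) = ecc_xi1 G * x u)" (is ?eig)
    and ecc_xi1_rayleigh: "(\<Sum>u\<in>pverts G. \<Sum>v\<in>pverts G. ecc_entry G u v * y u * y v)
      \<le> ecc_xi1 G * (\<Sum>u\<in>pverts G. (y u)\<^sup>2)" (is ?ray)
proof -
  let ?V = "pverts G"
  let ?S = "spectrum (ecc_matrix G (vertex_listing G))"
  have listing: "distinct (vertex_listing G) \<and> set (vertex_listing G) = ?V"
    unfolding vertex_listing_def by (rule someI_ex) (use finite_distinct_list[OF fin] in blast)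
  then have S: "?S = {k. \<exists>x. (\<exists>u\<in>?V. x u \<noteq> 0) \<and>
        (\<forall>u\<in>?V. (\<Sum>v\<in>?V. ecc_entry G u v * x v) = k * x u)}"
    by (intro spectrum_ecc_matrix) auto
  have "ecc_matrix G (vertex_listing G) \<in> carrier_mat (length (vertex_listing G)) (length (vertex_listing G))"
    by (simp add: ecc_matrix_def)
  then have finS: "finite ?S" by (rule card_finite_spectrum)
  have symE: "ecc_entry G u v = ecc_entry G v u" if "u \<in> ?V" "v \<in> ?V" for u v
    using sym[OF that] by (simp add: ecc_entry_def min.commute)
  obtain k x where kx: "\<exists>u\<in>?V. x u \<noteq> 0" "\<forall>u\<in>?V. (\<Sum>v\<in>?V. ecc_entry G u v * x v) = k * x u"
    "\<And>y. (\<Sum>u\<in>?V. \<Sum>v\<in>?V. ecc_entry G u v * y u * y v) \<le> k * (\<Sum>u\<in>?V. (y u)\<^sup>2)"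
    by (rule symmetric_top_eigenvector[where M = "ecc_entry G", OF fin ne])
      (erule (1) symE, rule that)
  have kS: "k \<in> ?S" unfolding S using kx(1,2) by blast
  then have "ecc_xi1 G \<in> ?S" unfolding ecc_xi1_def using finS by (intro Max_in) auto
  then show ?eig unfolding S by blast
  have "k \<le> ecc_xi1 G" unfolding ecc_xi1_def using finS kS by simp
  then have "k * (\<Sum>u\<in>?V. (y u)\<^sup>2) \<le> ecc_xi1 G * (\<Sum>u\<in>?V. (y u)\<^sup>2)"
    by (intro mult_right_mono sum_nonneg) auto
  with kx(3)[of y] show ?ray by linarith
qed

section \<open>The broom\<close>

text \<open>Vertex 3 and the attached pendant vertices are all leaves at 2. Hence labels from 3 on
  are truncated to position 3 of the path, except that two distinct such leaves are at distance
  2.\<close>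

definition broom_dist :: "nat \<Rightarrow> nat \<Rightarrow> nat" where
  "broom_dist u v =
     (if u = v then 0 else if 3 \<le> u \<and> 3 \<le> v then 2
      else if u \<le> v then min v 3 - u else min u 3 - v)"

lemma pverts_broom [simp]: "pverts (broom_tree n) = {0..<n}"
  by (simp add: broom_tree_def Let_def)

lemma parcs_broom:
  assumes "n \<ge> 4"
  shows "(x, y) \<in> parcs (broom_tree n) \<longleftrightarrow> x < n \<and> y < n \<and>
    (x = 0 \<and> y = 1 \<or> x = 1 \<and> y = 0 \<or> x = 1 \<and> y = 2 \<or> x = 2 \<and> y = 1 \<or>
     x = 2 \<and> 3 \<le> y \<or> 3 \<le> x \<and> y = 2)"
  using assms by (auto simp: broom_tree_def Let_def)

lemma gdist_broom:
  assumes n: "n \<ge> 4" and uv: "u < n" "v < n"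
  shows "gdist (broom_tree n) u v = broom_dist u v"
proof (rule pair_pre_digraph.gdist_eqI)
  show "broom_dist u y \<le> Suc (broom_dist u x)" if "(x, y) \<in> parcs (broom_tree n)" for x y
    using that unfolding parcs_broom[OF n] by (auto simp: broom_dist_def)
  show "\<exists>x\<in>pverts (broom_tree n). (x, w) \<in> parcs (broom_tree n) \<and>
      broom_dist u w = Suc (broom_dist u x)"
    if w: "w \<in> pverts (broom_tree n)" "w \<noteq> u" for w
  proof -
    \<comment> \<open>The neighbour of \<open>w\<close> on the path from \<open>u\<close>.\<close>
    define x where "x = (if w = 0 then 1 else if w = 1 then (if u = 0 then 0 else 2)
      else if w = 2 then (if u < 2 then 1 else u) else 2)"
    consider "w = 0" | "w = 1" | "w = 2" | "3 \<le> w" by linarith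
    then have "x < n \<and> (x, w) \<in> parcs (broom_tree n) \<and> broom_dist u w = Suc (broom_dist u x)"
      using w uv n unfolding parcs_broom[OF n] by cases (auto simp: x_def broom_dist_def)
    then show ?thesis by auto
  qed
qed (use uv in \<open>auto simp: broom_dist_def\<close>)

lemma eccentricity_broom:
  assumes n: "n \<ge> 4" and u: "u < n"
  shows "eccentricity (broom_tree n) u = (if u = 1 \<or> u = 2 then 2 else 3)"
proof -
  have "gdist (broom_tree n) u ` pverts (broom_tree n) = broom_dist u ` {0..<n}"
    using gdist_broom[OF n u] by auto
  moreover have "Max (broom_dist u ` {0..<n}) = (if u = 1 \<or> u = 2 then 2 else 3)"
  proof (rule Max_eqI)
    show "y \<le> (if u = 1 \<or> u = 2 then 2 else 3)" if "y \<in> broom_dist u ` {0..<n}" for y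
      using that by (auto simp: broom_dist_def)
    \<comment> \<open>A farthest vertex from \<open>u\<close> is the leaf 3 if \<open>u < 2\<close>,
      and the end 0 otherwise.\<close>
    have "(if u = 1 \<or> u = 2 then 2 else 3) = broom_dist u (if u < 2 then 3 else 0)"
      by (auto simp: broom_dist_def)
    then show "(if u = 1 \<or> u = 2 then 2 else 3) \<in> broom_dist u ` {0..<n}"
      using n by auto
  qed simp
  ultimately show ?thesis by (simp add: eccentricity_def)
qed

lemma ecc_entry_broom:
  assumes n: "n \<ge> 4" and uv: "u < n" "v < n"
  shows "ecc_entry (broom_tree n) u v =
    (if u = 0 \<and> 3 \<le> v \<or> v = 0 \<and> 3 \<le> u then 3
     else if u = 0 \<and> v = 2 \<or> u = 2 \<and> v = 0 \<or> u = 1 \<and> 3 \<le> v \<or> v = 1 \<and> 3 \<le> u then 2 else 0)"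
  unfolding ecc_entry_def eccentricity_broom[OF n uv(1)] eccentricity_broom[OF n uv(2)]
    gdist_broom[OF n uv]
  by (auto simp: broom_dist_def)

text \<open>The leaves at 2, \<open>m\<close> in number, enter the other equations only through
  their sum \<open>Y\<close>, so no symmetry of the eigenvector is required. If \<open>k\<close>
  were too large, the reduced system for \<open>x 0\<close>, \<open>x 1\<close>, \<open>x 2\<close>,
  \<open>Y\<close> would force the eigenvector to vanish.\<close>

lemma ecc_xi1_broom_square_le:
  assumes n: "n \<ge> 4"
  shows "(ecc_xi1 (broom_tree n))\<^sup>2 \<le> 13 * real n - 35"
proof -
  let ?E = "ecc_entry (broom_tree n)"
  define k where "k = ecc_xi1 (broom_tree n)"
  define m where "m = real n - 3"
  have m: "m \<ge> 1" using n by (simp add: m_def)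
  have "gdist (broom_tree n) u v = gdist (broom_tree n) v u" if "u < n" "v < n" for u v
    using that by (simp add: gdist_broom[OF n] broom_dist_def)
  then have "\<exists>x. (\<exists>u\<in>{0..<n}. x u \<noteq> 0) \<and> (\<forall>u\<in>{0..<n}. (\<Sum>v\<in>{0..<n}. ?E u v * x v) = k * x u)"
    using ecc_xi1_eigenvector[of "broom_tree n"] n by (simp add: k_def)
  then obtain x where nz: "\<exists>u\<in>{0..<n}. x u \<noteq> 0"
    and "\<forall>u\<in>{0..<n}. (\<Sum>v\<in>{0..<n}. ?E u v * x v) = k * x u" by blast
  then have eig: "(\<Sum>v\<in>{0..<n}. ?E u v * x v) = k * x u" if "u < n" for u
    using that by simp
  define Y where "Y = sum x {3..<n}"
  have split: "{0..<n} = {0, 1, 2} \<union> {3..<n}" using n by auto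
  have sum4: "(\<Sum>v\<in>{0..<n}. f v) = f 0 + f 1 + f 2 + sum f {3..<n}" for f :: "nat \<Rightarrow> real"
    unfolding split by (subst sum.union_disjoint) auto
  have e0: "k * x 0 = 3 * Y + 2 * x 2"
    using eig[of 0] n unfolding sum4 Y_def by (simp add: ecc_entry_broom sum_distrib_left)
  have e1: "k * x 1 = 2 * Y"
    using eig[of 1] n unfolding sum4 Y_def by (simp add: ecc_entry_broom sum_distrib_left)
  have e2: "k * x 2 = 2 * x 0"
    using eig[of 2] n unfolding sum4 by (simp add: ecc_entry_broom)
  have e3: "k * x u = 3 * x 0 + 2 * x 1" if "3 \<le> u" "u < n" for u
    using eig[of u] n that unfolding sum4 by (simp add: ecc_entry_broom)
  have "k * Y = (\<Sum>u\<in>{3..<n}. 3 * x 0 + 2 * x 1)"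
    unfolding Y_def sum_distrib_left by (intro sum.cong refl) (simp add: e3)
  then have eY: "k * Y = m * (3 * x 0 + 2 * x 1)" using n by (simp add: m_def of_nat_diff)
  have "k\<^sup>2 \<le> 13 * m + 4"
  proof (rule ccontr)
    assume "\<not> k\<^sup>2 \<le> 13 * m + 4"
    then have t: "k\<^sup>2 > 13 * m + 4" by simp
    then have k0: "k \<noteq> 0" using m by auto
    have "k\<^sup>2 * x 0 = k * (3 * Y + 2 * x 2)" using e0 by (simp add: power2_eq_square)
    then have a0: "(k\<^sup>2 - 4) * x 0 = 3 * (k * Y)" using e2 by (simp add: algebra_simps)
    have "k\<^sup>2 * Y = k * (m * (3 * x 0 + 2 * x 1))" using eY by (simp add: power2_eq_square)
    also have "\<dots> = m * (3 * (k * x 0) + 2 * (k * x 1))" by (simp add: algebra_simps)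
    finally have aY: "(k\<^sup>2 - 4 * m) * Y = 3 * m * (k * x 0)" using e1 by (simp add: algebra_simps)
    have "(k\<^sup>2 - 4 * m) * ((k\<^sup>2 - 4) * x 0) = 3 * k * ((k\<^sup>2 - 4 * m) * Y)"
      unfolding a0 by (simp add: algebra_simps)
    also have "\<dots> = 9 * m * k\<^sup>2 * x 0" unfolding aY by (simp add: power2_eq_square)
    \<comment> \<open>With t = k^2 the coefficient is (t - 4) (t - 4 m) - 9 m t, regrouped so that
      it is visibly positive for t > 13 m + 4.\<close>
    finally have "(k\<^sup>2 * (k\<^sup>2 - (13 * m + 4)) + 16 * m) * x 0 = 0"
      by (simp add: algebra_simps)
    moreover have "k\<^sup>2 * (k\<^sup>2 - (13 * m + 4)) \<ge> 0" using t by simp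
    then have "k\<^sup>2 * (k\<^sup>2 - (13 * m + 4)) + 16 * m > 0" using m by linarith
    ultimately have x0: "x 0 = 0" by simp
    then have Y0: "Y = 0" using a0 k0 by simp
    have "x 1 = 0" "x 2 = 0" using e1 e2 x0 Y0 k0 by auto
    moreover from this have "x u = 0" if "3 \<le> u" "u < n" for u using e3[OF that] x0 k0 by simp
    ultimately have "\<forall>u\<in>{0..<n}. x u = 0" using x0 unfolding split by auto
    with nz show False by blast
  qed
  then show ?thesis by (simp add: k_def m_def)
qed

section \<open>Trees of large diameter\<close>

context undirected_tree_graph begin

text \<open>Rayleigh quotient of the trial vector \<open>y\<close>. Entries are nonnegative, so
  terms inside \<open>{a, b}\<close> and inside its complement may be dropped. The mixed terms give
  \<open>s * W\<close> from each side, against squared norm \<open>2 * W\<close>.\<close>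

lemma ecc_xi1_ge_sqrt:
  assumes ab: "a \<in> V" "b \<in> V" "a \<noteq> b"
    and pos: "W > 0" and W: "W = (\<Sum>v\<in>V - {a, b}. (ecc_entry G v a + ecc_entry G v b)\<^sup>2)"
  shows "sqrt (W / 2) \<le> ecc_xi1 G"
proof -
  let ?E = "ecc_entry G"
  let ?U = "V - {a, b}"
  define w where "w v = ?E v a + ?E v b" for v
  \<comment> \<open>This choice gives \<open>{a, b}\<close> and its complement equal shares \<open>W\<close> of the squared norm.\<close>
  define s where "s = sqrt (W / 2)"
  define y where "y v = (if v \<in> {a, b} then s else w v)" for v
  have s: "s > 0" "s\<^sup>2 = W / 2" using pos by (simp_all add: s_def)
  have finV: "finite V" by (rule pair_finite_verts)
  have split: "(\<Sum>v\<in>V. f v) = f a + f b + (\<Sum>v\<in>?U. f v)" for f :: "'a \<Rightarrow> real"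
  proof -
    have "(\<Sum>v\<in>V. f v) = (\<Sum>v\<in>?U. f v) + (\<Sum>v\<in>{a, b}. f v)"
      using finV ab by (intro sum.subset_diff) auto
    then show ?thesis using ab(3) by simp
  qed
  have E0: "?E u v \<ge> 0" for u v by (simp add: ecc_entry_def)
  have w0: "w v \<ge> 0" for v by (simp add: w_def E0)
  have y0: "y v \<ge> 0" for v using s w0 by (simp add: y_def)
  have symE: "?E u v = ?E v u" if "u \<in> V" "v \<in> V" for u v
    using d_sym[OF that] by (simp add: ecc_entry_def min.commute)
  have W': "W = (\<Sum>v\<in>?U. (w v)\<^sup>2)" unfolding W w_def ..
  have norm: "(\<Sum>u\<in>V. (y u)\<^sup>2) = 2 * W"
    unfolding split using s W' by (simp add: y_def)
  define F where "F u = (\<Sum>v\<in>V. ?E u v * y u * y v)" for u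
  have term0: "?E u v * y u * y v \<ge> 0" for u v using E0 y0 by simp
  have FU: "s * (w u)\<^sup>2 \<le> F u" if u: "u \<in> ?U" for u
  proof -
    have "s * (w u)\<^sup>2 = ?E u a * y u * y a + ?E u b * y u * y b"
      using u by (simp add: y_def w_def algebra_simps power2_eq_square)
    also have "\<dots> \<le> F u" unfolding F_def split using term0 by (simp add: sum_nonneg)
    finally show ?thesis .
  qed
  have "s * W = (\<Sum>v\<in>?U. ?E a v * y a * y v) + (\<Sum>v\<in>?U. ?E b v * y b * y v)"
    unfolding W' sum_distrib_left sum.distrib[symmetric]
  proof (intro sum.cong refl)
    fix v assume v: "v \<in> ?U"
    then have "?E a v = ?E v a" "?E b v = ?E v b" using symE ab by auto
    then show "s * (w v)\<^sup>2 = ?E a v * y a * y v + ?E b v * y b * y v"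
      using v by (simp add: y_def w_def algebra_simps power2_eq_square)
  qed
  also have "\<dots> \<le> F a + F b" unfolding F_def split[of "\<lambda>v. ?E a v * y a * y v"]
      split[of "\<lambda>v. ?E b v * y b * y v"]
    using term0[of a a] term0[of a b] term0[of b a] term0[of b b] by linarith
  finally have "s * W \<le> F a + F b" .
  moreover have "s * W \<le> (\<Sum>u\<in>?U. F u)"
    unfolding W' sum_distrib_left by (intro sum_mono FU)
  ultimately have "2 * W * s \<le> (\<Sum>u\<in>V. F u)" unfolding split by (simp add: algebra_simps)
  also have "\<dots> \<le> ecc_xi1 G * (2 * W)"
    using ecc_xi1_rayleigh[of G y, OF finV _ d_sym] ab unfolding F_def norm by auto
  finally show ?thesis using pos by (simp add: s_def mult.commute)
qed

section \<open>Matrix entries at a diametral pair\<close>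

text \<open>Apply the four-point condition to \<open>v\<close>, \<open>w\<close>, \<open>a\<close>,
  \<open>b\<close>: since \<open>d w a\<close> and \<open>d w b\<close> are at most
  \<open>d a b\<close>, they cancel against it.\<close>

lemma eccentricity_diametral:
  assumes ab: "a \<in> V" "b \<in> V" and diam: "\<And>u v. u \<in> V \<Longrightarrow> v \<in> V \<Longrightarrow> d u v \<le> d a b"
    and v: "v \<in> V"
  shows "eccentricity G v = max (d v a) (d v b)"
  unfolding eccentricity_def
proof (rule Max_eqI)
  show "y \<le> max (d v a) (d v b)" if y: "y \<in> d v ` V" for y
  proof -
    obtain w where w: "w \<in> V" "y = d v w" using y by blast
    then show ?thesis
      using four_point[OF v w(1) ab] diam[OF w(1) ab(1)] diam[OF w(1) ab(2)] by linarith
  qed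
qed (use ab pair_finite_verts in \<open>auto simp: max_def\<close>)

text \<open>The larger of the two distances is the eccentricity of \<open>v\<close>, and it is at
  most \<open>d a b\<close>, the eccentricity of both \<open>a\<close> and \<open>b\<close>. So it
  is the minimum in the matrix entry.\<close>

lemma ecc_entries_to_diametral:
  assumes ab: "a \<in> V" "b \<in> V" and diam: "\<And>u v. u \<in> V \<Longrightarrow> v \<in> V \<Longrightarrow> d u v \<le> d a b"
    and v: "v \<in> V"
  shows "d v b \<le> d v a \<Longrightarrow> ecc_entry G v a = real (d v a)"
    and "d v a \<le> d v b \<Longrightarrow> ecc_entry G v b = real (d v b)"
proof -
  have ecc: "eccentricity G u = max (d u a) (d u b)" if "u \<in> V" for u
    using eccentricity_diametral[OF ab diam that] .
  have "d v a \<le> d a b" "d v b \<le> d a b" using diam v ab by auto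
  moreover have "d b a = d a b" using d_sym ab by blast
  ultimately show "d v b \<le> d v a \<Longrightarrow> ecc_entry G v a = real (d v a)"
    "d v a \<le> d v b \<Longrightarrow> ecc_entry G v b = real (d v b)"
    unfolding ecc_entry_def ecc[OF v] ecc[OF ab(1)] ecc[OF ab(2)]
    using d_refl ab by simp_all
qed

text \<open>Equal distances contribute twice, at least \<open>d a b\<close> in total. Otherwise the
  larger one counts alone; if it is at most 5, the sum of both is 8 or 9 and at least
  \<open>d a b\<close>. Parity rules out a sum of 9 with \<open>d a b = 8\<close>, so
  \<open>v\<close> lies on the diametral path at distance 5 from an end, which is excluded.\<close>

lemma ecc_entries_to_diametral_ge:
  assumes ab: "a \<in> V" "b \<in> V" and diam: "\<And>u v. u \<in> V \<Longrightarrow> v \<in> V \<Longrightarrow> d u v \<le> d a b"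
    and D: "d a b \<ge> 8" and v: "v \<in> V"
    and off: "\<not> (d a v = 5 \<and> d a v + d v b = d a b)" "\<not> (d a v + d v b = d a b \<and> d v b = 5)"
  shows "6 \<le> ecc_entry G v a + ecc_entry G v b"
proof -
  note entries = ecc_entries_to_diametral[OF ab diam v]
  have E0: "ecc_entry G v u \<ge> 0" for u by (simp add: ecc_entry_def)
  have sym: "d a v = d v a" using d_sym ab v by blast
  have par: "even (d v a + d v b + d a b)" by (rule d_parity[OF ab v])
  have tri: "d a b \<le> d v a + d v b" using d_triangle[OF ab(1) v ab(2)] sym by simp
  have odd: "d v a + d v b \<noteq> Suc (d a b)" using par by presburger
  consider "d v a = d v b" | "d v b < d v a" | "d v a < d v b" by linarith
  then show ?thesis
  proof cases
    case 1
    then have "ecc_entry G v a + ecc_entry G v b = real (2 * d v a)" using entries by simp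
    also have "\<dots> \<ge> 6" using 1 tri D by linarith
    finally show ?thesis .
  next
    case 2
    then have "d v a \<ge> 6" using tri D off sym odd by linarith
    then show ?thesis using 2 entries(1) E0[of b] by simp
  next
    case 3
    then have "d v b \<ge> 6" using tri D off sym odd by linarith
    then show ?thesis using 3 entries(2) E0[of a] by simp
  qed
qed

lemma ecc_xi1_square_ge:
  assumes D: "graph_diameter G \<ge> 8" and n: "card V \<ge> 5"
  shows "18 * (real (card V) - 4) \<le> (ecc_xi1 G)\<^sup>2" "0 \<le> ecc_xi1 G"
proof -
  have finV: "finite V" by (rule pair_finite_verts)
  have "V \<noteq> {}" using n by auto
  then have "graph_diameter G \<in> eccentricity G ` V"
    unfolding graph_diameter_def using finV by (intro Max_in) auto
  then obtain a where a: "a \<in> V" "graph_diameter G = eccentricity G a" by blast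
  have "eccentricity G a \<in> d a ` V"
    unfolding eccentricity_def using finV a(1) by (intro Max_in) auto
  then obtain b where b: "b \<in> V" "graph_diameter G = d a b" using a(2) by auto
  have diam: "d u v \<le> d a b" if "u \<in> V" "v \<in> V" for u v
  proof -
    have "d u v \<le> eccentricity G u"
      unfolding eccentricity_def using finV that by simp
    also have "\<dots> \<le> graph_diameter G"
      unfolding graph_diameter_def using finV that by simp
    finally show ?thesis using b(2) by simp
  qed
  have dab: "d a b \<ge> 8" using D b(2) by simp
  then have ne: "a \<noteq> b" using d_refl[OF a(1)] by auto
  let ?w = "\<lambda>v. ecc_entry G v a + ecc_entry G v b"
  let ?X = "{v \<in> V. d a v = 5 \<and> d a v + d v b = d a b}"
  let ?Y = "{v \<in> V. d a v + d v b = d a b \<and> d v b = 5}"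
  \<comment> \<open>The ends \<open>a\<close>, \<open>b\<close> do not occur in the sum
    \<open>W\<close>. \<open>?X\<close> and \<open>?Y\<close> collect the vertices where the bound 6
    may fail; each has at most one element, as a point of a geodesic is determined by its
    position.\<close>
  let ?Z = "{a} \<union> {b} \<union> ?X \<union> ?Y"
  have uniq: "u = v" if "u \<in> V" "v \<in> V" "d a u = d a v" "d u b = d v b" "d a u + d u b = d a b" for u v
    by (rule geodesic_point_unique[OF a(1) b(1) that(1,2,3,5)])
      (use that(4) d_sym[OF b(1) that(1)] d_sym[OF b(1) that(2)] in simp)
  have fin: "finite ?X" "finite ?Y" using finV by auto
  have "u = v" if "u \<in> ?X" "v \<in> ?X" for u v
  proof -
    have "d a u = d a v" "d u b = d v b" using that by auto
    then show ?thesis using that by (intro uniq) auto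
  qed
  moreover have "u = v" if "u \<in> ?Y" "v \<in> ?Y" for u v
  proof -
    have "d a u = d a v" "d u b = d v b" using that by auto
    then show ?thesis using that by (intro uniq) auto
  qed
  ultimately have "\<forall>u\<in>?X. \<forall>v\<in>?X. u = v" "\<forall>u\<in>?Y. \<forall>v\<in>?Y. u = v" by blast+
  then have "card ?X \<le> 1" "card ?Y \<le> 1"
    using card_le_Suc0_iff_eq[OF fin(1)] card_le_Suc0_iff_eq[OF fin(2)] by simp_all
  then have "card ?Z \<le> 4"
    using card_Un_le[of "{a} \<union> {b} \<union> ?X" ?Y] card_Un_le[of "{a} \<union> {b}" ?X]
      card_Un_le[of "{a}" "{b}"] by simp
  moreover have "card V - card ?Z \<le> card (V - ?Z)"
    using finV by (intro diff_card_le_card_Diff) auto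
  ultimately have card: "real (card V) - 4 \<le> real (card (V - ?Z))" by linarith
  define W where "W = (\<Sum>v\<in>V - {a, b}. (?w v)\<^sup>2)"
  have "36 * (real (card V) - 4) \<le> (\<Sum>v\<in>V - ?Z. 36 :: real)" using card by simp
  also have "\<dots> \<le> (\<Sum>v\<in>V - ?Z. (?w v)\<^sup>2)"
  proof (intro sum_mono)
    fix v assume "v \<in> V - ?Z"
    then have "6 \<le> ?w v"
      by (intro ecc_entries_to_diametral_ge[OF a(1) b(1) diam dab]) auto
    then have "6\<^sup>2 \<le> (?w v)\<^sup>2" by (intro power_mono) auto
    then show "36 \<le> (?w v)\<^sup>2" by simp
  qed
  also have "\<dots> \<le> W" unfolding W_def using finV by (intro sum_mono2) auto
  finally have W: "36 * (real (card V) - 4) \<le> W" .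
  then have "W > 0" using n by simp
  then have le: "sqrt (W / 2) \<le> ecc_xi1 G"
    using ecc_xi1_ge_sqrt[OF a(1) b(1) ne _ W_def] by simp
  then show "0 \<le> ecc_xi1 G" using \<open>W > 0\<close> real_sqrt_ge_zero[of "W / 2"] by linarith
  have "W / 2 \<le> (ecc_xi1 G)\<^sup>2" using le \<open>W > 0\<close> by (intro sqrt_le_D)
  then show "18 * (real (card V) - 4) \<le> (ecc_xi1 G)\<^sup>2" using W by simp
qed

end

theorem theorem4p7:
  fixes T :: "'a pair_pre_digraph" and n :: nat
  assumes "undirected_tree T"
    and "card (pverts T) = n"
    and "n \<ge> 16"
    and "graph_diameter T \<ge> 8"
  shows "ecc_xi1 T > ecc_xi1 (broom_tree n)"
proof -
  have "undirected_tree_graph T"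
    using assms(1) by (intro undirected_tree_graph.intro undirected_tree_graph_axioms.intro)
      (simp_all add: undirected_tree_def)
  then have T: "18 * (real n - 4) \<le> (ecc_xi1 T)\<^sup>2" "0 \<le> ecc_xi1 T"
    using undirected_tree_graph.ecc_xi1_square_ge[of T] assms(2-4) by simp_all
  have "(ecc_xi1 (broom_tree n))\<^sup>2 \<le> 13 * real n - 35"
    using assms(3) by (intro ecc_xi1_broom_square_le) simp
  \<comment> \<open>The gap is \<open>5 * real n - 37\<close>.\<close>
  also have "\<dots> < 18 * (real n - 4)" using assms(3) by simp
  also note T(1)
  finally show ?thesis using T(2) by (rule power2_less_imp_less)
qed

end
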